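(* Let $G$ be a connected graph with vertex set $\{v_1,\ldots,v_n\}$ and with $m \geq 4$ edges, and let $\mathcal{G}$ be the unlabeled graph (isomorphism class) containing $G$. Suppose that for every automorphism $\pi \in \mathrm{Aut}(G)$ other than the identity, with cycle decomposition $C_1 \ldots C_s$ (including $1$-cycles), the following holds: if for each $i \in [s]$ the vertices in $C_i$ are pairwise nonadjacent in $G$, then $s \leq n-2$. Then there exists $N \in \mathbb{N}$ such that $P_{\ell}(\mathcal{G},k) = P(\mathcal{G},k)$ for all integers $k \geq N$.
   Context: All graphs are finite and simple. An unlabeled graph $\mathcal{G}$ of order $n$ is an isomorphism class of graphs, each with vertex set $\{v_1,\ldots,v_n\}$. A list assignment $L$ for a graph $G$ assigns to each vertex $v$ a set $L(v)$ of colors; it is a $k$-assignment if $|L(v)|=k$ for all $v$. A proper $L$-coloring is a proper coloring $f$ with $f(v)\in L(v)$ for all $v$. For $G \in \mathcal{G}$ and a $k$-assignment $L$ of $G$, two proper $L$-colorings $f,g$ of $G$ are equivalent if $f\pi = g$ for some $\pi \in \mathrm{Aut}(G)$; $u_\ell(G,L)$ denotes the number of equivalence classes. The unlabeled list color function $P_\ell(\mathcal{G},k)$ is the minimum of $u_\ell(G,L)$ over all $k$-assignments $L$ of $G$ (for an arbitrarily chosen $G\in\mathcal{G}$). The unlabeled chromatic polynomial $P(\mathcal{G},k)$ (Hanlon) is the number of orbits of the symmetric group $S_n$ on $\{v_1,\dots,v_n\}$ acting on the set of pairs $(G,f)$ with $G\in\mathcal{G}$ and $f$ a proper coloring of $G$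 with colors from $[k]$, via $\pi\cdot(G,f) = (\pi G, f\pi^{-1})$, where $\pi G$ has edge set $\{\pi(v_i)\pi(v_j) : v_iv_j\in E(G)\}$; equivalently, it is $u_\ell(G,L)$ for the $k$-assignment $L$ with $L(v)=[k]$ for all $v$. *)

theory Defs
  imports "HOL-Library.FuncSet" "HOL-Combinatorics.Permutations" "HOL-Combinatorics.Orbits"
begin

text \<open>
  A graph is given by its vertex set \<open>V\<close> (the set of the vertices v1, ..., vn) and its edge set
  \<open>E\<close>, whose elements are two-element subsets of \<open>V\<close>. All members of an unlabeled graph have the
  same vertex set \<open>V\<close>, so an unlabeled graph is a set of edge sets.
\<close>

definition simple_graph :: "'a set \<Rightarrow> 'a set set \<Rightarrow> bool" where
  "simple_graph V E \<longleftrightarrow> finite V \<and> (\<forall>e\<in>E. e \<subseteq> V \<and> card e = 2)"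

definition connected_graph :: "'a set \<Rightarrow> 'a set set \<Rightarrow> bool" where
  "connected_graph V E \<longleftrightarrow> V \<noteq> {} \<and> (\<forall>u\<in>V. \<forall>v\<in>V. (u, v) \<in> {(x, y). {x, y} \<in> E}\<^sup>*)"

definition permute_graph :: "('a \<Rightarrow> 'a) \<Rightarrow> 'a set set \<Rightarrow> 'a set set" where
  "permute_graph p E = (\<lambda>e. p ` e) ` E"

definition Aut :: "'a set \<Rightarrow> 'a set set \<Rightarrow> ('a \<Rightarrow> 'a) set" where
  "Aut V E = {p. p permutes V \<and> permute_graph p E = E}"

definition unlabeled_graph :: "'a set \<Rightarrow> 'a set set \<Rightarrow> 'a set set set" where
  "unlabeled_graph V E =
     {E'. simple_graph V E' \<and> (\<exists>p. p permutes V \<and> E' = permute_graph p E)}"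

text \<open>
  The vertex sets of the cycles in the cycle decomposition of a permutation of \<open>V\<close>. Since
  \<open>orbit p v = {v}\<close> when \<open>p v = v\<close>, the 1-cycles are included.
\<close>

definition cycles_of_perm :: "'a set \<Rightarrow> ('a \<Rightarrow> 'a) \<Rightarrow> 'a set set" where
  "cycles_of_perm V p = orbit p ` V"

definition pairwise_nonadjacent :: "'a set set \<Rightarrow> 'a set \<Rightarrow> bool" where
  "pairwise_nonadjacent E C \<longleftrightarrow> (\<forall>u\<in>C. \<forall>v\<in>C. {u, v} \<notin> E)"

text \<open>
  Colors are natural numbers. Finiteness is required separately because the cardinality of an
  infinite set is 0.
\<close>

definition k_assignment :: "'a set \<Rightarrow> nat \<Rightarrow> ('a \<Rightarrow> nat set) \<Rightarrow> bool" where
  "k_assignment V k L \<longleftrightarrow> (\<forall>v\<in>V. finite (L v) \<and> card (L v) = k)"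

text \<open>
  Colorings are functions on \<open>V\<close>, i.e. extensional outside \<open>V\<close>. This is preserved by composition
  with a permutation of \<open>V\<close>, which fixes everything outside \<open>V\<close>.
\<close>

definition proper_colorings :: "'a set \<Rightarrow> 'a set set \<Rightarrow> ('a \<Rightarrow> nat set) \<Rightarrow> ('a \<Rightarrow> nat) set" where
  "proper_colorings V E L = {f \<in> Pi\<^sub>E V L. \<forall>u v. {u, v} \<in> E \<longrightarrow> f u \<noteq> f v}"

definition coloring_equiv ::
    "'a set \<Rightarrow> 'a set set \<Rightarrow> ('a \<Rightarrow> nat set) \<Rightarrow> (('a \<Rightarrow> nat) \<times> ('a \<Rightarrow> nat)) set" where
  "coloring_equiv V E L =
     {(f, g). f \<in> proper_colorings V E L \<and> g \<in> proper_colorings V E L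
        \<and> (\<exists>p\<in>Aut V E. f \<circ> p = g)}"

definition u_list :: "'a set \<Rightarrow> 'a set set \<Rightarrow> ('a \<Rightarrow> nat set) \<Rightarrow> nat" where
  "u_list V E L = card (proper_colorings V E L // coloring_equiv V E L)"

text \<open>
  The choice operator renders the arbitrarily chosen representative of the class \<open>\<G>\<close>. The infimum
  is over a nonempty set of natural numbers and hence a minimum.
\<close>

definition unlabeled_list_color_function :: "'a set \<Rightarrow> 'a set set set \<Rightarrow> nat \<Rightarrow> nat" where
  "unlabeled_list_color_function V \<G> k =
     (let E = (SOME E. E \<in> \<G>) in Inf {u_list V E L | L. k_assignment V k L})"

definition colored_graphs ::
    "'a set \<Rightarrow> 'a set set set \<Rightarrow> nat \<Rightarrow> ('a set set \<times> ('a \<Rightarrow> nat)) set" where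
  "colored_graphs V \<G> k = {(E, f). E \<in> \<G> \<and> f \<in> proper_colorings V E (\<lambda>v. {1..k})}"

definition permute_colored_graph ::
    "('a \<Rightarrow> 'a) \<Rightarrow> 'a set set \<times> ('a \<Rightarrow> nat) \<Rightarrow> 'a set set \<times> ('a \<Rightarrow> nat)" where
  "permute_colored_graph p = (\<lambda>(E, f). (permute_graph p E, f \<circ> inv p))"

definition unlabeled_chromatic_polynomial :: "'a set \<Rightarrow> 'a set set set \<Rightarrow> nat \<Rightarrow> nat" where
  "unlabeled_chromatic_polynomial V \<G> k =
     card ((\<lambda>x. {permute_colored_graph p x | p. p permutes V}) ` colored_graphs V \<G> k)"

end

theory Submission
  imports Defs
begin

text \<open>
  Burnside's double count shows that \<open>u_list V E L * card (Aut V E)\<close> is at least the sum over the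
  automorphisms \<open>p\<close> of the number of proper \<open>L\<close>-colorings fixed by \<open>p\<close>, with equality for constant
  lists. Compare \<open>L\<close> with the constant assignment \<open>K = L v0\<close>, and let \<open>D\<close> be the sum over the edges
  \<open>uv\<close> of \<open>k - card (L u \<inter> L v)\<close>. Connectedness gives \<open>card (K - L v) \<le> 2 * D\<close>. Hence for each
  \<open>p \<noteq> id\<close> the hypothesis on cycles bounds the loss by a constant times \<open>D * k ^ (n - 3)\<close>. For
  \<open>p = id\<close>, in the inclusion-exclusion over sets of monochromatic edges the single edges contribute
  a gain of at least \<open>D * k ^ (n - 2)\<close>, while sets with two or more edges again change by at most a
  constant times \<open>D * k ^ (n - 3)\<close>. So the gain dominates for large \<open>k\<close>, uniformly in \<open>L\<close>.
\<close>

section \<open>Automorphism classes of colorings\<close>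

definition fixed_colorings ::
    "'a set \<Rightarrow> 'a set set \<Rightarrow> ('a \<Rightarrow> nat set) \<Rightarrow> ('a \<Rightarrow> 'a) \<Rightarrow> ('a \<Rightarrow> nat) set" where
  "fixed_colorings V E L p = {f \<in> proper_colorings V E L. f \<circ> p = f}"

section \<open>Vertex permutations and the automorphism group\<close>

lemma permute_graph_comp: "permute_graph (p \<circ> q) E = permute_graph p (permute_graph q E)"
  by (simp add: permute_graph_def image_image image_comp)

lemma permute_graph_id [simp]: "permute_graph id E = E"
  by (simp add: permute_graph_def)

lemma permute_graph_inv:
  assumes "p permutes V"
  shows "permute_graph (inv p) (permute_graph p E) = E"
  by (simp flip: permute_graph_comp add: permutes_inv_o[OF assms])

lemma Aut_id [simp]: "id \<in> Aut V E"
  by (simp add: Aut_def permutes_id)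

lemma Aut_comp: "p \<in> Aut V E \<Longrightarrow> q \<in> Aut V E \<Longrightarrow> p \<circ> q \<in> Aut V E"
  by (simp add: Aut_def permutes_compose permute_graph_comp)

lemma Aut_inv: "p \<in> Aut V E \<Longrightarrow> inv p \<in> Aut V E"
  unfolding Aut_def using permute_graph_inv[of p V E] by (auto simp: permutes_inv)

lemma finite_Aut: "finite V \<Longrightarrow> finite (Aut V E)"
  unfolding Aut_def by (rule finite_subset[OF _ finite_permutations]) auto

lemma permute_graph_edge_iff:
  assumes "p permutes V"
  shows "{p u, p v} \<in> permute_graph p E \<longleftrightarrow> {u, v} \<in> E"
proof -
  have "p ` e \<in> permute_graph p E \<longleftrightarrow> e \<in> E" for e
    by (auto simp: permute_graph_def inj_image_eq_iff[OF permutes_inj[OF assms]])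
  from this[of "{u, v}"] show ?thesis
    by simp
qed

lemma Aut_edge_iff:
  assumes "p \<in> Aut V E"
  shows "{p u, p v} \<in> E \<longleftrightarrow> {u, v} \<in> E"
  using assms permute_graph_edge_iff[of p V u v E] by (simp add: Aut_def)

lemma finite_proper_colorings:
  assumes "finite V" "\<And>v. v \<in> V \<Longrightarrow> finite (L v)"
  shows "finite (proper_colorings V E L)"
proof (rule finite_subset)
  show "proper_colorings V E L \<subseteq> PiE V L"
    by (auto simp: proper_colorings_def)
  show "finite (PiE V L)"
    using assms by (intro finite_PiE)
qed

section \<open>Equivalence classes of colorings and Burnside's count\<close>

lemma equiv_coloring: "equiv (proper_colorings V E L) (coloring_equiv V E L)"
proof (rule equivI)
  show "coloring_equiv V E L \<subseteq> proper_colorings V E L \<times> proper_colorings V E L"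
    by (auto simp: coloring_equiv_def)
  show "refl_on (proper_colorings V E L) (coloring_equiv V E L)"
    by (auto simp: refl_on_def coloring_equiv_def intro!: bexI[of _ id])
  show "sym (coloring_equiv V E L)"
  proof (rule symI)
    fix f g assume "(f, g) \<in> coloring_equiv V E L"
    then obtain p where p: "p \<in> Aut V E" "f \<circ> p = g"
      and fg: "f \<in> proper_colorings V E L" "g \<in> proper_colorings V E L"
      by (auto simp: coloring_equiv_def)
    have "p \<circ> inv p = id"
      using p(1) by (auto simp: Aut_def intro: permutes_inv_o)
    then have "g \<circ> inv p = f"
      using p(2) by (metis comp_assoc comp_id)
    then show "(g, f) \<in> coloring_equiv V E L"
      using fg Aut_inv[OF p(1)] by (auto simp: coloring_equiv_def)
  qed
  show "trans (coloring_equiv V E L)"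
  proof (rule transI)
    fix f g h
    assume "(f, g) \<in> coloring_equiv V E L" "(g, h) \<in> coloring_equiv V E L"
    then obtain p q where p: "p \<in> Aut V E" "f \<circ> p = g" and q: "q \<in> Aut V E" "g \<circ> q = h"
      and fh: "f \<in> proper_colorings V E L" "h \<in> proper_colorings V E L"
      by (auto simp: coloring_equiv_def)
    have "f \<circ> (p \<circ> q) = h"
      using p q by (simp flip: comp_assoc)
    then show "(f, h) \<in> coloring_equiv V E L"
      using fh Aut_comp[OF p(1) q(1)] by (auto simp: coloring_equiv_def)
  qed
qed

text \<open>If \<open>g = f \<circ> q\<close>, then left composition with \<open>q\<close> carries
  the stabilizer of \<open>g\<close> onto the set of automorphisms taking \<open>f\<close> to
  \<open>g\<close>. As \<open>g\<close> runs over the class of \<open>f\<close>, these sets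
  partition the automorphisms that keep \<open>f\<close> within the lists.\<close>

lemma sum_card_stabilizers_class:
  assumes "finite V" "\<And>v. v \<in> V \<Longrightarrow> finite (L v)" and f: "f \<in> proper_colorings V E L"
  shows "(\<Sum>g\<in>coloring_equiv V E L `` {f}. card {p \<in> Aut V E. g \<circ> p = g})
    = card {p \<in> Aut V E. f \<circ> p \<in> proper_colorings V E L}"
proof -
  let ?c = "coloring_equiv V E L `` {f}"
  have finX: "finite (proper_colorings V E L)"
    using assms finite_proper_colorings by blast
  have c: "?c \<subseteq> proper_colorings V E L"
    by (auto simp: coloring_equiv_def)
  have finc: "finite ?c"
    using finX c finite_subset by blast
  have coset: "card {p \<in> Aut V E. g \<circ> p = g} = card {p \<in> Aut V E. f \<circ> p = g}" if g: "g \<in> ?c" for g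
  proof -
    obtain q where q: "q \<in> Aut V E" "f \<circ> q = g"
      using g unfolding coloring_equiv_def by blast
    have qq: "q \<circ> inv q = id" "inv q \<circ> q = id"
      using q(1) by (auto simp: Aut_def intro: permutes_inv_o)
    have "bij_betw (\<lambda>p. q \<circ> p) {p \<in> Aut V E. g \<circ> p = g} {p \<in> Aut V E. f \<circ> p = g}"
    proof (rule bij_betw_byWitness[where f' = "\<lambda>p. inv q \<circ> p"])
      show "\<forall>a\<in>{p \<in> Aut V E. g \<circ> p = g}. inv q \<circ> (q \<circ> a) = a"
        using qq by (metis comp_assoc id_comp)
      show "\<forall>a\<in>{p \<in> Aut V E. f \<circ> p = g}. q \<circ> (inv q \<circ> a) = a"
        using qq by (metis comp_assoc id_comp)
      show "(\<circ>) q ` {p \<in> Aut V E. g \<circ> p = g} \<subseteq> {p \<in> Aut V E. f \<circ> p = g}"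
        using q Aut_comp by (auto simp flip: comp_assoc)
      have "g \<circ> inv q = f"
        using qq(1) q(2) by (metis comp_assoc comp_id)
      then show "(\<circ>) (inv q) ` {p \<in> Aut V E. f \<circ> p = g} \<subseteq> {p \<in> Aut V E. g \<circ> p = g}"
        using Aut_comp Aut_inv[OF q(1)] by (auto simp flip: comp_assoc)
    qed
    then show ?thesis
      by (rule bij_betw_same_card)
  qed
  have "{p \<in> Aut V E. f \<circ> p \<in> proper_colorings V E L} = (\<Union>g\<in>?c. {p \<in> Aut V E. f \<circ> p = g})"
    using f by (auto simp: coloring_equiv_def)
  also have "card \<dots> = (\<Sum>g\<in>?c. card {p \<in> Aut V E. f \<circ> p = g})"
    by (rule card_UN_disjoint) (use finc finite_Aut[OF \<open>finite V\<close>] in auto)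
  also have "\<dots> = (\<Sum>g\<in>?c. card {p \<in> Aut V E. g \<circ> p = g})"
    by (rule sum.cong[OF refl]) (rule coset[symmetric])
  finally show ?thesis ..
qed

text \<open>
  Burnside's double count. A class contains only those colorings of an orbit that respect the
  lists, so for nonconstant lists the inner sums may be smaller than \<open>card (Aut V E)\<close>.
\<close>

lemma sum_card_fixed_colorings:
  assumes "finite V" "\<And>v. v \<in> V \<Longrightarrow> finite (L v)"
  shows "(\<Sum>p\<in>Aut V E. card (fixed_colorings V E L p))
    = (\<Sum>c\<in>proper_colorings V E L // coloring_equiv V E L.
        \<Sum>g\<in>c. card {p \<in> Aut V E. g \<circ> p = g})"
proof -
  let ?X = "proper_colorings V E L" and ?r = "coloring_equiv V E L"
  have finX: "finite ?X"
    using assms finite_proper_colorings by blast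
  have finA: "finite (Aut V E)"
    using assms(1) finite_Aut by blast
  have "(\<Sum>p\<in>Aut V E. card (fixed_colorings V E L p))
      = (\<Sum>p\<in>Aut V E. \<Sum>f\<in>?X. if f \<circ> p = f then 1 else 0)"
    using finX by (simp add: fixed_colorings_def sum.If_cases Int_def)
  also have "\<dots> = (\<Sum>f\<in>?X. \<Sum>p\<in>Aut V E. if f \<circ> p = f then 1 else 0)"
    by (rule sum.swap)
  also have "\<dots> = (\<Sum>f\<in>?X. card {p \<in> Aut V E. f \<circ> p = f})"
    using finA by (simp add: sum.If_cases Int_def)
  also have "\<dots> = (\<Sum>f\<in>\<Union>(?X // ?r). card {p \<in> Aut V E. f \<circ> p = f})"
    by (simp add: Union_quotient[OF equiv_coloring])
  also have "\<dots> = (\<Sum>c\<in>?X // ?r. \<Sum>g\<in>c. card {p \<in> Aut V E. g \<circ> p = g})"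
  proof (subst sum.Union_disjoint)
    have "c \<subseteq> ?X" if "c \<in> ?X // ?r" for c
      using that Union_quotient[OF equiv_coloring, of V E L] by blast
    then show "\<forall>c\<in>?X // ?r. finite c"
      using finX finite_subset by blast
    show "\<forall>c\<in>?X // ?r. \<forall>d\<in>?X // ?r. c \<noteq> d \<longrightarrow> c \<inter> d = {}"
      using quotient_disj[OF equiv_coloring, of _ V E L] by blast
  qed simp
  finally show ?thesis .
qed

lemma sum_card_fixed_colorings_le:
  assumes "finite V" "\<And>v. v \<in> V \<Longrightarrow> finite (L v)"
  shows "(\<Sum>p\<in>Aut V E. card (fixed_colorings V E L p)) \<le> u_list V E L * card (Aut V E)"
proof -
  have "(\<Sum>g\<in>c. card {p \<in> Aut V E. g \<circ> p = g}) \<le> card (Aut V E)"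
    if c: "c \<in> proper_colorings V E L // coloring_equiv V E L" for c
  proof -
    obtain f where f: "f \<in> proper_colorings V E L" "c = coloring_equiv V E L `` {f}"
      using c by (auto simp: quotient_def)
    have "card {p \<in> Aut V E. f \<circ> p \<in> proper_colorings V E L} \<le> card (Aut V E)"
      by (rule card_mono[OF finite_Aut[OF assms(1)]]) auto
    then show ?thesis
      using sum_card_stabilizers_class[of V L f E] assms f by simp
  qed
  then show ?thesis
    using sum_bounded_above[of "proper_colorings V E L // coloring_equiv V E L" _ "card (Aut V E)"]
      sum_card_fixed_colorings[of V L E] assms by (simp add: u_list_def)
qed

section \<open>Constant list assignments\<close>

text \<open>Constant lists do not notice a permutation of the vertices, so here the whole group acts
  on the proper colorings. This is what turns Burnside's inequality into an equality.\<close>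

lemma proper_colorings_const_comp:
  assumes "f \<in> proper_colorings V E (\<lambda>_. K)" "p \<in> Aut V E"
  shows "f \<circ> p \<in> proper_colorings V E (\<lambda>_. K)"
proof -
  have p: "p permutes V"
    using assms(2) by (simp add: Aut_def)
  then show ?thesis
    using assms(1) Aut_edge_iff[OF assms(2)] permutes_in_image[OF p]
    by (auto simp: proper_colorings_def PiE_def extensional_def)
qed

lemma sum_card_fixed_colorings_const:
  assumes "finite V" "finite K"
  shows "(\<Sum>p\<in>Aut V E. card (fixed_colorings V E (\<lambda>_. K) p))
    = u_list V E (\<lambda>_. K) * card (Aut V E)"
proof -
  let ?L = "\<lambda>_::'a. K"
  have "(\<Sum>g\<in>c. card {p \<in> Aut V E. g \<circ> p = g}) = card (Aut V E)"
    if c: "c \<in> proper_colorings V E ?L // coloring_equiv V E ?L" for c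
  proof -
    obtain f where f: "f \<in> proper_colorings V E ?L" "c = coloring_equiv V E ?L `` {f}"
      using c by (auto simp: quotient_def)
    have "{p \<in> Aut V E. f \<circ> p \<in> proper_colorings V E ?L} = Aut V E"
      using proper_colorings_const_comp[OF f(1)] by auto
    then show ?thesis
      unfolding f(2) using sum_card_stabilizers_class[of V ?L f E] assms f(1) by simp
  qed
  then show ?thesis
    using sum_card_fixed_colorings[of V ?L E] assms by (simp add: u_list_def)
qed

text \<open>Renaming colors along an injection preserves both properness and invariance under
  \<open>p\<close>. The lemma serves to replace \<open>{1..k}\<close> by the list of a chosen
  vertex.\<close>

lemma card_fixed_colorings_const_le:
  assumes "finite V" "finite K" "finite K'" "card K \<le> card K'" "p permutes V" "simple_graph V E"
  shows "card (fixed_colorings V E (\<lambda>_. K) p) \<le> card (fixed_colorings V E (\<lambda>_. K') p)"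
proof -
  obtain b where b: "inj_on b K" "b ` K \<subseteq> K'"
    using card_le_inj[OF assms(2-4)] by blast
  \<comment> \<open>The renaming \<open>b\<close> need not fix \<open>undefined\<close>, so the
    extensional value outside \<open>V\<close> is restored by restriction.\<close>
  let ?h = "\<lambda>f. restrict (b \<circ> f) V"
  have inV: "u \<in> V \<and> v \<in> V" if "{u, v} \<in> E" for u v
    using that assms(6) by (auto simp: simple_graph_def)
  show ?thesis
  proof (rule card_inj_on_le[of ?h])
    show "inj_on ?h (fixed_colorings V E (\<lambda>_. K) p)"
    proof (rule inj_onI)
      fix f g assume fg: "f \<in> fixed_colorings V E (\<lambda>_. K) p" "g \<in> fixed_colorings V E (\<lambda>_. K) p"
        and eq: "?h f = ?h g"
      have "f x = g x" if "x \<in> V" for x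
      proof -
        have "b (f x) = b (g x)"
          using fun_cong[OF eq, of x] that by simp
        moreover have "f x \<in> K" "g x \<in> K"
          using fg that by (auto simp: fixed_colorings_def proper_colorings_def)
        ultimately show ?thesis
          using b(1) by (auto dest: inj_onD)
      qed
      then show "f = g"
        using fg by (auto simp: fixed_colorings_def proper_colorings_def intro: PiE_ext)
    qed
    show "?h ` fixed_colorings V E (\<lambda>_. K) p \<subseteq> fixed_colorings V E (\<lambda>_. K') p"
    proof (rule image_subsetI)
      fix f assume f: "f \<in> fixed_colorings V E (\<lambda>_. K) p"
      have fK: "f x \<in> K" if "x \<in> V" for x
        using f that by (auto simp: fixed_colorings_def proper_colorings_def)
      have "?h f \<in> PiE V (\<lambda>_. K')"
        using fK b(2) by auto
      moreover have "?h f u \<noteq> ?h f v" if "{u, v} \<in> E" for u v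
      proof -
        have "f u \<noteq> f v"
          using f that by (simp add: fixed_colorings_def proper_colorings_def)
        then have "b (f u) \<noteq> b (f v)"
          using inj_onD[OF b(1)] fK inV[OF that] by blast
        then show ?thesis
          using inV[OF that] by simp
      qed
      moreover have "?h f \<circ> p = ?h f"
      proof
        fix x
        have "f (p x) = f x"
          using f by (auto simp: fixed_colorings_def fun_eq_iff)
        then show "(?h f \<circ> p) x = ?h f x"
          using permutes_in_image[OF assms(5)] by (auto simp: restrict_def)
      qed
      ultimately show "?h f \<in> fixed_colorings V E (\<lambda>_. K') p"
        by (auto simp: fixed_colorings_def proper_colorings_def)
    qed
    show "finite (fixed_colorings V E (\<lambda>_. K') p)"
      using finite_proper_colorings[of V "\<lambda>_. K'" E] assms(1,3) by (simp add: fixed_colorings_def)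
  qed
qed

section \<open>Unlabeled graphs\<close>

text \<open>Classes of a kernel correspond to the values of \<open>h\<close>. Later \<open>h\<close>
  sends a coloring to its class in another quotient, or to its orbit, so that two ways of counting
  can be compared.\<close>

lemma card_quotient_kernel:
  assumes "\<And>x y. (x, y) \<in> r \<longleftrightarrow> x \<in> A \<and> y \<in> A \<and> h x = h y"
  shows "card (A // r) = card (h ` A)"
proof -
  have "r `` {x} = {y \<in> A. h y = h x}" if "x \<in> A" for x
    using assms that by auto
  then have "A // r = (\<lambda>z. {y \<in> A. h y = z}) ` h ` A"
    by (auto simp: quotient_def image_def)
  moreover have "inj_on (\<lambda>z. {y \<in> A. h y = z}) (h ` A)"
    by (rule inj_onI) blast
  ultimately show ?thesis
    by (simp add: card_image)
qed

section \<open>Transport along a permutation of the vertices\<close>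

lemma proper_colorings_permute:
  assumes q: "q permutes V"
  shows "(f \<circ> q \<in> proper_colorings V E (L \<circ> q))
    \<longleftrightarrow> f \<in> proper_colorings V (permute_graph q E) L"
proof -
  have "f \<circ> q \<in> PiE V (L \<circ> q) \<longleftrightarrow> f \<in> PiE V L"
  proof -
    have "(\<forall>x\<in>V. f (q x) \<in> L (q x)) \<longleftrightarrow> (\<forall>x\<in>V. f x \<in> L x)"
      using permutes_image[OF q] by (metis imageE image_eqI)
    moreover have "(\<forall>x. x \<notin> V \<longrightarrow> f (q x) = undefined) \<longleftrightarrow> (\<forall>x. x \<notin> V \<longrightarrow> f x = undefined)"
      using permutes_not_in[OF q] by auto
    ultimately show ?thesis
      by (auto simp: PiE_def Pi_def extensional_def)
  qed
  moreover have "(\<forall>u v. {u, v} \<in> E \<longrightarrow> f (q u) \<noteq> f (q v))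
      \<longleftrightarrow> (\<forall>u v. {u, v} \<in> permute_graph q E \<longrightarrow> f u \<noteq> f v)"
  proof -
    have "(\<forall>u v. {u, v} \<in> permute_graph q E \<longrightarrow> f u \<noteq> f v)
      \<longleftrightarrow> (\<forall>u v. {q u, q v} \<in> permute_graph q E \<longrightarrow> f (q u) \<noteq> f (q v))"
      using permutes_surj[OF q] by (metis surjD)
    then show ?thesis
      by (simp add: permute_graph_edge_iff[OF q])
  qed
  ultimately show ?thesis
    by (simp add: proper_colorings_def)
qed

text \<open>The conjugate of \<open>p\<close> maps the permuted graph to the image under
  \<open>q\<close> of \<open>permute_graph p E\<close>, and permuting edge sets by \<open>q\<close>
  is injective.\<close>

lemma Aut_permute_graph:
  assumes q: "q permutes V"
  shows "q \<circ> p \<circ> inv q \<in> Aut V (permute_graph q E) \<longleftrightarrow> p \<in> Aut V E"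
proof -
  have qq: "q \<circ> inv q = id" "inv q \<circ> q = id"
    using permutes_inv_o[OF q] by auto
  have p: "inv q \<circ> (q \<circ> p \<circ> inv q) \<circ> q = p"
    using qq by (metis comp_assoc comp_id id_comp)
  have "q \<circ> p \<circ> inv q permutes V \<longleftrightarrow> p permutes V"
    using p q by (metis permutes_compose permutes_inv)
  moreover have "permute_graph (q \<circ> p \<circ> inv q) (permute_graph q E) = permute_graph q (permute_graph p E)"
    using qq by (simp flip: permute_graph_comp add: comp_assoc)
  moreover have "permute_graph q (permute_graph p E) = permute_graph q E \<longleftrightarrow> permute_graph p E = E"
    using permute_graph_inv[OF q] by metis
  ultimately show ?thesis
    by (simp add: Aut_def)
qed

text \<open>Composition with \<open>q\<close> is a bijection between the two sets of proper
  colorings, and conjugating automorphisms by \<open>q\<close> shows that it respects equivalence in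
  both directions.\<close>

lemma u_list_permute_graph:
  assumes q: "q permutes V"
  shows "u_list V (permute_graph q E) L = u_list V E (L \<circ> q)"
proof -
  let ?E = "permute_graph q E"
  let ?X = "proper_colorings V ?E L" and ?Y = "proper_colorings V E (L \<circ> q)"
  have qq: "q \<circ> inv q = id" "inv q \<circ> q = id"
    using permutes_inv_o[OF q] by auto
  have equiv_iff: "(f, g) \<in> coloring_equiv V ?E L \<longleftrightarrow>
      (f \<circ> q, g \<circ> q) \<in> coloring_equiv V E (L \<circ> q)" for f g
  proof -
    have "(\<exists>p\<in>Aut V ?E. f \<circ> p = g) \<longleftrightarrow> (\<exists>p\<in>Aut V E. f \<circ> q \<circ> p = g \<circ> q)"
    proof
      assume "\<exists>p\<in>Aut V ?E. f \<circ> p = g"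
      then obtain p where p: "p \<in> Aut V ?E" "f \<circ> p = g"
        by blast
      have "q \<circ> (inv q \<circ> p \<circ> q) \<circ> inv q = p"
        using qq by (metis comp_assoc comp_id id_comp)
      then have "inv q \<circ> p \<circ> q \<in> Aut V E"
        using p(1) Aut_permute_graph[OF q] by metis
      moreover have "f \<circ> q \<circ> (inv q \<circ> p \<circ> q) = g \<circ> q"
        using p(2) qq by (metis comp_assoc comp_id)
      ultimately show "\<exists>p\<in>Aut V E. f \<circ> q \<circ> p = g \<circ> q"
        by blast
    next
      assume "\<exists>p\<in>Aut V E. f \<circ> q \<circ> p = g \<circ> q"
      then obtain p where p: "p \<in> Aut V E" "f \<circ> q \<circ> p = g \<circ> q"
        by blast
      have "f \<circ> (q \<circ> p \<circ> inv q) = g"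
        using p(2) qq by (metis comp_assoc comp_id)
      then show "\<exists>p\<in>Aut V ?E. f \<circ> p = g"
        using p(1) Aut_permute_graph[OF q] by blast
    qed
    then show ?thesis
      by (simp add: coloring_equiv_def proper_colorings_permute[OF q])
  qed
  have Y: "?Y = (\<lambda>f. f \<circ> q) ` ?X"
  proof (intro set_eqI iffI)
    fix g assume g: "g \<in> ?Y"
    have "g \<circ> inv q \<circ> q = g"
      using qq by (metis comp_assoc comp_id)
    then show "g \<in> (\<lambda>f. f \<circ> q) ` ?X"
      using g proper_colorings_permute[OF q] by (metis image_eqI)
  qed (auto simp: proper_colorings_permute[OF q])
  let ?r = "coloring_equiv V E (L \<circ> q)"
  let ?c = "\<lambda>g. ?r `` {g}"
  \<comment> \<open>Equivalence for the permuted graph is the kernel of sending \<open>f\<close> to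
    the class of \<open>f \<circ> q\<close>, so its classes are counted by the classes that are hit,
    which by \<open>Y\<close> are all of them.\<close>
  have "(f, g) \<in> coloring_equiv V ?E L \<longleftrightarrow> f \<in> ?X \<and> g \<in> ?X \<and> ?c (f \<circ> q) = ?c (g \<circ> q)" for f g
    using equiv_iff[of f g] eq_equiv_class_iff[OF equiv_coloring, of "f \<circ> q" V E "L \<circ> q" "g \<circ> q"]
      proper_colorings_permute[OF q]
    by (auto simp: coloring_equiv_def)
  then have "u_list V ?E L = card ((\<lambda>f. ?c (f \<circ> q)) ` ?X)"
    unfolding u_list_def by (rule card_quotient_kernel)
  also have "(\<lambda>f. ?c (f \<circ> q)) ` ?X = ?Y // ?r"
    unfolding Y by (auto simp: quotient_def)
  finally show ?thesis
    by (simp add: u_list_def)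
qed

section \<open>Both counting functions expressed through a fixed graph\<close>

text \<open>The chosen representative is \<open>E\<close> permuted by some \<open>q\<close>, and as
  \<open>L\<close> runs over all \<open>k\<close>-assignments so does \<open>L \<circ> q\<close>.
  The two sets of values therefore agree, although the values for a single \<open>L\<close> may
  differ.\<close>

lemma unlabeled_list_color_function_eq:
  assumes "simple_graph V E"
  shows "unlabeled_list_color_function V (unlabeled_graph V E) k
    = Inf {u_list V E L | L. k_assignment V k L}"
proof -
  let ?G = "unlabeled_graph V E"
  have "E \<in> ?G"
    using assms permutes_id[of V] by (auto simp: unlabeled_graph_def intro!: exI[of _ id])
  then have "(SOME E. E \<in> ?G) \<in> ?G"
    by (rule someI)
  then obtain q where q: "q permutes V" "(SOME E. E \<in> ?G) = permute_graph q E"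
    by (auto simp: unlabeled_graph_def)
  have k: "k_assignment V k (L \<circ> p)" if "k_assignment V k L" "p permutes V" for L :: "'a \<Rightarrow> nat set" and p
    using that permutes_in_image[OF that(2)] by (auto simp: k_assignment_def)
  have "{u_list V (permute_graph q E) L | L. k_assignment V k L}
      = {u_list V E L | L. k_assignment V k L}"
  proof (intro set_eqI iffI)
    fix x assume "x \<in> {u_list V (permute_graph q E) L | L. k_assignment V k L}"
    then show "x \<in> {u_list V E L | L. k_assignment V k L}"
      using u_list_permute_graph[OF q(1)] k[OF _ q(1)] by blast
  next
    fix x assume "x \<in> {u_list V E L | L. k_assignment V k L}"
    then obtain L where L: "x = u_list V E L" "k_assignment V k L"
      by blast
    have "L \<circ> inv q \<circ> q = L"
      using permutes_inv_o[OF q(1)] by (metis comp_assoc comp_id)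
    then have "x = u_list V (permute_graph q E) (L \<circ> inv q)"
      using L(1) u_list_permute_graph[OF q(1)] by metis
    then show "x \<in> {u_list V (permute_graph q E) L | L. k_assignment V k L}"
      using k[OF L(2) permutes_inv[OF q(1)]] by blast
  qed
  then show ?thesis
    by (simp add: unlabeled_list_color_function_def q(2))
qed

text \<open>Every orbit of colored graphs contains one with edge set \<open>E\<close>, and two
  colorings of \<open>E\<close> lie in the same orbit exactly if an automorphism of \<open>E\<close>
  relates them.\<close>

lemma unlabeled_chromatic_polynomial_eq:
  assumes "simple_graph V E"
  shows "unlabeled_chromatic_polynomial V (unlabeled_graph V E) k = u_list V E (\<lambda>_. {1..k})"
proof -
  let ?L = "\<lambda>_::'a. {1..k}"
  let ?X = "proper_colorings V E ?L"
  define Q where "Q x = {permute_colored_graph p x | p. p permutes V}" for x :: "'a set set \<times> ('a \<Rightarrow> nat)"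
  have pcg: "permute_colored_graph p (permute_colored_graph q x) = permute_colored_graph (p \<circ> q) x"
    if "p permutes V" "q permutes V" for p q x
    using that
    by (cases x) (simp add: permute_colored_graph_def permute_graph_comp o_inv_distrib permutes_bij comp_assoc)
  have Q_sub: "Q (permute_colored_graph q x) \<subseteq> Q x" if "q permutes V" for q x
    unfolding Q_def using pcg that permutes_compose by blast
  have Q_permute: "Q (permute_colored_graph q x) = Q x" if q: "q permutes V" for q x
  proof
    have "permute_colored_graph (inv q) (permute_colored_graph q x) = x"
      by (simp only: pcg[OF permutes_inv[OF q] q] permutes_inv_o[OF q])
        (cases x, simp add: permute_colored_graph_def)
    then show "Q x \<subseteq> Q (permute_colored_graph q x)"
      using Q_sub[OF permutes_inv[OF q]] by metis
  qed (use Q_sub q in blast)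
  have self: "x \<in> Q x" for x
    unfolding Q_def using permutes_id[of V]
    by (cases x) (auto simp: permute_colored_graph_def intro!: exI[of _ id])
  have Q_iff: "Q (E, f) = Q (E, g) \<longleftrightarrow> (\<exists>p\<in>Aut V E. f \<circ> p = g)" for f g
  proof
    assume "Q (E, f) = Q (E, g)"
    then have "(E, g) \<in> Q (E, f)"
      using self by simp
    then obtain p where p: "p permutes V" "permute_graph p E = E" "f \<circ> inv p = g"
      unfolding Q_def permute_colored_graph_def by auto
    then show "\<exists>p\<in>Aut V E. f \<circ> p = g"
      using Aut_inv[of p V E] by (auto simp: Aut_def)
  next
    assume "\<exists>p\<in>Aut V E. f \<circ> p = g"
    then obtain p where p: "p \<in> Aut V E" "f \<circ> p = g"
      by blast
    have "inv p permutes V" "permute_colored_graph (inv p) (E, f) = (E, g)"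
      using Aut_inv[OF p(1)] p
      by (auto simp: Aut_def permute_colored_graph_def inv_inv_eq permutes_bij)
    then show "Q (E, f) = Q (E, g)"
      using Q_permute by metis
  qed
  have "Q ` colored_graphs V (unlabeled_graph V E) k = (\<lambda>f. Q (E, f)) ` ?X"
  proof (intro set_eqI iffI)
    fix x assume "x \<in> Q ` colored_graphs V (unlabeled_graph V E) k"
    then obtain q f where q: "q permutes V" and x: "x = Q (permute_graph q E, f)"
      and f: "f \<in> proper_colorings V (permute_graph q E) ?L"
      by (auto simp: colored_graphs_def unlabeled_graph_def)
    have "f \<circ> q \<in> ?X"
      using proper_colorings_permute[OF q, of f E ?L] f by (simp add: comp_def)
    moreover have "permute_colored_graph q (E, f \<circ> q) = (permute_graph q E, f)"
      using permutes_inv_o[OF q] by (simp add: permute_colored_graph_def comp_assoc)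
    ultimately show "x \<in> (\<lambda>f. Q (E, f)) ` ?X"
      using Q_permute[OF q] x by (metis image_eqI)
  next
    have "E \<in> unlabeled_graph V E"
      using assms permutes_id[of V] by (auto simp: unlabeled_graph_def intro!: exI[of _ id])
    then show "x \<in> Q ` colored_graphs V (unlabeled_graph V E) k" if "x \<in> (\<lambda>f. Q (E, f)) ` ?X" for x
      using that by (auto simp: colored_graphs_def)
  qed
  moreover have "u_list V E ?L = card ((\<lambda>f. Q (E, f)) ` ?X)"
    unfolding u_list_def by (rule card_quotient_kernel) (auto simp: coloring_equiv_def Q_iff)
  ultimately show ?thesis
    by (simp add: unlabeled_chromatic_polynomial_def Q_def[abs_def])
qed

section \<open>Comparing list assignments\<close>

text \<open>
  The set \<open>T\<close> plays the role of a transversal: the constraints defining \<open>F\<close> leave at most the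
  values on \<open>T\<close> free.
\<close>

lemma card_determined_le:
  fixes M :: "'a \<Rightarrow> nat set"
  assumes "finite V" "T \<subseteq> V" "v \<in> T" and M: "k_assignment V k M" and S: "finite S"
    and F: "F \<subseteq> PiE V M" "\<And>f. f \<in> F \<Longrightarrow> f v \<in> S"
    and det: "\<And>f g. f \<in> F \<Longrightarrow> g \<in> F \<Longrightarrow> (\<forall>x\<in>T. f x = g x) \<Longrightarrow> (\<forall>x\<in>V. f x = g x)"
  shows "card F \<le> card S * k ^ (card T - 1)"
proof -
  have finT: "finite T"
    using assms finite_subset by blast
  have MT: "finite (M x)" "card (M x) = k" if "x \<in> T" for x
    using M that \<open>T \<subseteq> V\<close> by (auto simp: k_assignment_def)
  \<comment> \<open>By \<open>det\<close>, restriction to \<open>T\<close> is injective. The update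
    at \<open>v\<close> records the extra constraint, so one factor \<open>k\<close> is replaced by
    \<open>card S\<close>.\<close>
  have "card F \<le> card (PiE T (M(v := S)))"
  proof (rule card_inj_on_le[of "\<lambda>f. restrict f T"])
    show "inj_on (\<lambda>f. restrict f T) F"
    proof (rule inj_onI)
      fix f g assume fg: "f \<in> F" "g \<in> F" "restrict f T = restrict g T"
      then have "\<forall>x\<in>T. f x = g x"
        by (metis restrict_apply')
      then have "\<forall>x\<in>V. f x = g x"
        using det fg by blast
      then show "f = g"
        using fg F(1) by (meson PiE_ext subsetD)
    qed
    show "(\<lambda>f. restrict f T) ` F \<subseteq> PiE T (M(v := S))"
      using F \<open>T \<subseteq> V\<close> by fastforce
    show "finite (PiE T (M(v := S)))"
      using finT MT S by (intro finite_PiE) auto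
  qed
  also have "\<dots> = card S * (\<Prod>x\<in>T - {v}. card (M x))"
    using finT \<open>v \<in> T\<close> by (simp add: card_PiE prod.remove)
  also have "\<dots> = card S * k ^ (card T - 1)"
    using MT \<open>v \<in> T\<close> finT by simp
  finally show ?thesis .
qed

text \<open>A function that fits \<open>M\<close> but not \<open>M'\<close> takes at some
  \<open>v\<close> a value in \<open>M v - M' v\<close>. With a determining set through this
  \<open>v\<close>, there are at most \<open>d\<close> choices at \<open>v\<close> and at most
  \<open>k ^ r\<close> choices elsewhere; summing over \<open>v\<close> bounds the loss. This is why
  \<open>T\<close> may depend on \<open>v\<close> but must contain it.\<close>

lemma card_lists_diff_le:
  fixes M M' :: "'a \<Rightarrow> nat set"
  assumes "finite V" and M: "k_assignment V k M" "k_assignment V k M'" and "k \<ge> 1"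
    and det: "\<And>v. v \<in> V \<Longrightarrow> \<exists>T\<subseteq>V. v \<in> T \<and> card T \<le> Suc r \<and>
      (\<forall>f g. Q f \<longrightarrow> Q g \<longrightarrow> (\<forall>x\<in>T. f x = g x) \<longrightarrow> (\<forall>x\<in>V. f x = g x))"
    and d: "\<And>v. v \<in> V \<Longrightarrow> card (M v - M' v) \<le> d"
  shows "card {f \<in> PiE V M. Q f} \<le> card {f \<in> PiE V M'. Q f} + card V * (d * k ^ r)"
proof -
  let ?B = "\<lambda>v. {f \<in> PiE V M. Q f \<and> f v \<in> M v - M' v}"
  have fin: "finite (PiE V M)" "finite (PiE V M')"
    using M \<open>finite V\<close> by (auto simp: k_assignment_def intro!: finite_PiE)
  have B: "card (?B v) \<le> d * k ^ r" if "v \<in> V" for v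
  proof -
    obtain T where T: "T \<subseteq> V" "v \<in> T" "card T \<le> Suc r"
      "\<And>f g. Q f \<Longrightarrow> Q g \<Longrightarrow> (\<forall>x\<in>T. f x = g x) \<Longrightarrow> (\<forall>x\<in>V. f x = g x)"
      using det[OF \<open>v \<in> V\<close>] by blast
    have "card (?B v) \<le> card (M v - M' v) * k ^ (card T - 1)"
      using \<open>finite V\<close> T M \<open>v \<in> V\<close>
      by (intro card_determined_le[of V T v k M]) (auto simp: k_assignment_def)
    also have "\<dots> \<le> d * k ^ r"
      using d \<open>v \<in> V\<close> T(3) \<open>k \<ge> 1\<close> by (intro mult_mono power_increasing) auto
    finally show ?thesis .
  qed
  have "{f \<in> PiE V M. Q f} \<subseteq> {f \<in> PiE V M'. Q f} \<union> (\<Union>v\<in>V. ?B v)"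
  proof
    fix f assume f: "f \<in> {f \<in> PiE V M. Q f}"
    show "f \<in> {f \<in> PiE V M'. Q f} \<union> (\<Union>v\<in>V. ?B v)"
    proof (cases "\<forall>v\<in>V. f v \<in> M' v")
      case True
      then have "f \<in> PiE V M'"
        using f by (auto simp: PiE_def)
      then show ?thesis
        using f by simp
    next
      case False
      then show ?thesis
        using f by auto
    qed
  qed
  then have "card {f \<in> PiE V M. Q f} \<le> card ({f \<in> PiE V M'. Q f} \<union> (\<Union>v\<in>V. ?B v))"
    using fin \<open>finite V\<close> by (intro card_mono) auto
  also have "\<dots> \<le> card {f \<in> PiE V M'. Q f} + card (\<Union>v\<in>V. ?B v)"
    by (rule card_Un_le)
  also have "card (\<Union>v\<in>V. ?B v) \<le> (\<Sum>v\<in>V. card (?B v))"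
    by (rule card_UN_le[OF \<open>finite V\<close>])
  also have "\<dots> \<le> card V * (d * k ^ r)"
    using sum_bounded_above[of V "\<lambda>v. card (?B v)"] B by simp
  finally show ?thesis
    by simp
qed

section \<open>Vertex sets on which a constrained coloring is determined\<close>

text \<open>A coloring fixed by \<open>p\<close> is constant on each cycle, so one vertex from each
  cycle determines it.\<close>

lemma cycles_determine:
  assumes "finite V" and p: "p permutes V" and "v \<in> V"
  shows "\<exists>T\<subseteq>V. v \<in> T \<and> card T \<le> card (cycles_of_perm V p) \<and>
    (\<forall>f g. f \<circ> p = f \<longrightarrow> g \<circ> p = g \<longrightarrow> (\<forall>x\<in>T. f x = g x) \<longrightarrow> (\<forall>x\<in>V. f x = g x))"
proof -
  have perm: "permutation p"
    using assms permutation_permutes by blast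
  \<comment> \<open>Preferring \<open>v\<close> forces the transversal to pass through
    \<open>v\<close>, as \<open>card_lists_diff_le\<close> requires.\<close>
  define rep where "rep C = (if v \<in> C then v else SOME x. x \<in> C)" for C
  have rep: "rep (orbit p x) \<in> orbit p x" for x
    unfolding rep_def using permutation_self_in_orbit[OF perm, of x] someI by auto
  let ?T = "rep ` cycles_of_perm V p"
  have const: "f y = f x" if "f \<circ> p = f" "y \<in> orbit p x" for f :: "'a \<Rightarrow> 'b" and x y
    using that(2) that(1) by induct (auto simp: fun_eq_iff)
  show ?thesis
  proof (intro exI[of _ ?T] conjI allI impI ballI)
    show "?T \<subseteq> V"
      unfolding cycles_of_perm_def using permutes_orbit_subset[OF p] rep by blast
    have "v = rep (orbit p v)"
      using permutation_self_in_orbit[OF perm, of v] by (simp add: rep_def)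
    then show "v \<in> ?T"
      using \<open>v \<in> V\<close> unfolding cycles_of_perm_def by blast
    show "card ?T \<le> card (cycles_of_perm V p)"
      using \<open>finite V\<close> by (intro card_image_le) (simp add: cycles_of_perm_def)
    fix f g :: "'a \<Rightarrow> 'b" and x
    assume fg: "f \<circ> p = f" "g \<circ> p = g" and eq: "\<forall>x\<in>?T. f x = g x" and "x \<in> V"
    then have "f (rep (orbit p x)) = g (rep (orbit p x))"
      by (auto simp: cycles_of_perm_def)
    then show "f x = g x"
      by (simp add: const[OF fg(1) rep] const[OF fg(2) rep])
  qed
qed

definition monochromatic :: "('a \<Rightarrow> 'b) \<Rightarrow> 'a set \<Rightarrow> bool" where
  "monochromatic f e \<longleftrightarrow> (\<forall>x\<in>e. \<forall>y\<in>e. f x = f y)"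

text \<open>Two distinct edges impose two independent equations, so the colors of two vertices can
  be recovered from the rest. Each edge has an endpoint outside the other, and these two are left
  out; if one of them is \<open>v\<close>, the other endpoint of its edge is left out
  instead.\<close>

lemma two_edges_determine:
  assumes G: "simple_graph V E" and e: "e1 \<in> E" "e2 \<in> E" "e1 \<noteq> e2" and "v \<in> V"
  shows "\<exists>T\<subseteq>V. v \<in> T \<and> card T + 2 \<le> card V \<and>
    (\<forall>f g. monochromatic f e1 \<and> monochromatic f e2 \<longrightarrow> monochromatic g e1 \<and> monochromatic g e2 \<longrightarrow>
      (\<forall>x\<in>T. f x = g x) \<longrightarrow> (\<forall>x\<in>V. f x = g x))"
proof -
  have finV: "finite V" and sub: "e1 \<subseteq> V" "e2 \<subseteq> V" and c: "card e1 = 2" "card e2 = 2"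
    using G e by (auto simp: simple_graph_def)
  have fin: "finite e1" "finite e2"
    using c by (auto intro: card_ge_0_finite)
  have "\<not> e1 \<subseteq> e2" "\<not> e2 \<subseteq> e1"
    using card_subset_eq fin c e(3) by metis+
  then obtain a c where ac: "a \<in> e1" "a \<notin> e2" "c \<in> e2" "c \<notin> e1"
    by blast
  obtain b where b: "e1 = {a, b}" "a \<noteq> b"
    using \<open>card e1 = 2\<close> ac(1) by (auto simp: card_2_iff)
  obtain d where d: "e2 = {c, d}" "c \<noteq> d"
    using \<open>card e2 = 2\<close> ac(3) by (auto simp: card_2_iff)
  have V: "a \<in> V" "b \<in> V" "c \<in> V" "d \<in> V" and ne: "a \<noteq> c" "a \<noteq> d" "b \<noteq> c"
    using sub b d ac by auto
  \<comment> \<open>It remains to find two vertices other than \<open>v\<close> whose colors follow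
    from those of all other vertices.\<close>
  have T: ?thesis if xy: "x \<noteq> y" "x \<in> V" "y \<in> V" "v \<noteq> x" "v \<noteq> y"
    and det: "\<And>f g::'a \<Rightarrow> 'b. \<lbrakk>f a = f b; f c = f d; g a = g b; g c = g d; \<And>z. z \<in> V \<Longrightarrow> z \<noteq> x \<Longrightarrow> z \<noteq> y \<Longrightarrow> f z = g z\<rbrakk>
      \<Longrightarrow> f x = g x \<and> f y = g y" for x y
  proof (intro exI[of _ "V - {x, y}"] conjI allI impI)
    have "card {x, y} = 2" "{x, y} \<subseteq> V"
      using xy by auto
    then show "card (V - {x, y}) + 2 \<le> card V"
      using card_Diff_subset[of "{x, y}" V] card_mono[OF finV, of "{x, y}"] by simp
    fix f g :: "'a \<Rightarrow> 'b"
    assume "monochromatic f e1 \<and> monochromatic f e2" "monochromatic g e1 \<and> monochromatic g e2"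
      and eq: "\<forall>z\<in>V - {x, y}. f z = g z"
    then have "f a = f b" "f c = f d" "g a = g b" "g c = g d"
      unfolding monochromatic_def b(1) d(1) by blast+
    then have "f x = g x \<and> f y = g y"
      using det[of f g] eq by blast
    then show "\<forall>z\<in>V. f z = g z"
      using eq by blast
  qed (use \<open>v \<in> V\<close> xy in auto)
  consider "v \<noteq> a" "v \<noteq> c" | "v = a" | "v = c"
    by blast
  then show ?thesis
  proof cases
    case 1
    show ?thesis
    proof (rule T[of a c])
      fix f g :: "'a \<Rightarrow> 'b"
      assume *: "f a = f b" "f c = f d" "g a = g b" "g c = g d"
        "\<And>z. z \<in> V \<Longrightarrow> z \<noteq> a \<Longrightarrow> z \<noteq> c \<Longrightarrow> f z = g z"
      then show "f a = g a \<and> f c = g c"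
        using *(5)[of b] *(5)[of d] V ne b(2) d(2) by simp
    qed (use 1 V ne in auto)
  next
    case 2
    show ?thesis
    proof (rule T[of b c])
      fix f g :: "'a \<Rightarrow> 'b"
      assume *: "f a = f b" "f c = f d" "g a = g b" "g c = g d"
        "\<And>z. z \<in> V \<Longrightarrow> z \<noteq> b \<Longrightarrow> z \<noteq> c \<Longrightarrow> f z = g z"
      have "f a = g a"
        using V ne b(2) by (intro *(5)) auto
      then have "f b = g b"
        using *(1,3) by metis
      \<comment> \<open>The edges may share the vertex \<open>b = d\<close>; then the equation just
        proved already covers \<open>d\<close>.\<close>
      moreover have "f d = g d" if "d \<noteq> b"
        using V that d(2) by (intro *(5)) auto
      ultimately show "f b = g b \<and> f c = g c"
        using *(2,4) by metis
    qed (use 2 V ne b(2) in auto)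
  next
    case 3
    show ?thesis
    proof (rule T[of d a])
      fix f g :: "'a \<Rightarrow> 'b"
      assume *: "f a = f b" "f c = f d" "g a = g b" "g c = g d"
        "\<And>z. z \<in> V \<Longrightarrow> z \<noteq> d \<Longrightarrow> z \<noteq> a \<Longrightarrow> f z = g z"
      have "f c = g c"
        using V ne d(2) by (intro *(5)) auto
      then have "f d = g d"
        using *(2,4) by metis
      moreover have "f b = g b" if "b \<noteq> d"
        using V that b(2) by (intro *(5)) auto
      ultimately show "f d = g d \<and> f a = g a"
        using *(1,3) by metis
    qed (use 3 V ne d(2) in auto)
  qed
qed

section \<open>Inclusion-exclusion over monochromatic edges\<close>

text \<open>For each \<open>f\<close> the indicator of properness is the product over the edges of 1
  minus the indicator of being monochromatic. Expanding the product and exchanging the sums gives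
  the formula.\<close>

lemma card_proper_colorings_inclusion_exclusion:
  assumes G: "simple_graph V E" and fin: "\<And>v. v \<in> V \<Longrightarrow> finite (L v)"
  shows "int (card (proper_colorings V E L)) =
    (\<Sum>A\<in>Pow E. (- 1) ^ card A * int (card {f \<in> PiE V L. \<forall>e\<in>A. monochromatic f e}))"
proof -
  have finE: "finite E"
    using G by (intro finite_subset[of E "Pow V"]) (auto simp: simple_graph_def)
  have finP: "finite (PiE V L)"
    using G fin by (intro finite_PiE) (auto simp: simple_graph_def)
  have proper: "(\<forall>u v. {u, v} \<in> E \<longrightarrow> f u \<noteq> f v) \<longleftrightarrow> (\<forall>e\<in>E. \<not> monochromatic f e)" for f :: "'a \<Rightarrow> nat"
  proof -
    have mono: "monochromatic f {u, v} \<longleftrightarrow> f u = f v" for u v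
      by (auto simp: monochromatic_def)
    show ?thesis
    proof (intro iffI ballI)
      fix e assume *: "\<forall>u v. {u, v} \<in> E \<longrightarrow> f u \<noteq> f v" and "e \<in> E"
      moreover from \<open>e \<in> E\<close> obtain u v where "e = {u, v}"
        using G unfolding simple_graph_def by (metis card_2_iff)
      ultimately show "\<not> monochromatic f e"
        by (simp add: mono)
    qed (auto simp flip: mono)
  qed
  have ind: "(if \<forall>e\<in>E. \<not> monochromatic f e then 1 else 0)
      = (\<Sum>A\<in>Pow E. (- 1) ^ card A * (if \<forall>e\<in>A. monochromatic f e then 1 else 0 :: int))" for f :: "'a \<Rightarrow> nat"
  proof -
    have "(if \<forall>e\<in>E. \<not> monochromatic f e then 1 else 0)
        = (\<Prod>e\<in>E. (if monochromatic f e then - 1 else 0) + (1 :: int))"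
      using finE by (auto simp: prod_zero_iff intro!: prod.neutral)
    also have "\<dots> = (\<Sum>A\<in>Pow E. \<Prod>e\<in>A. if monochromatic f e then - 1 else 0)"
      by (simp add: prod_add[OF finE])
    also have "\<dots> = (\<Sum>A\<in>Pow E. (- 1) ^ card A * (if \<forall>e\<in>A. monochromatic f e then 1 else 0))"
    proof (rule sum.cong[OF refl])
      fix A assume "A \<in> Pow E"
      then have "finite A"
        using finE finite_subset by blast
      then show "(\<Prod>e\<in>A. if monochromatic f e then - 1 else 0)
          = (- 1) ^ card A * (if \<forall>e\<in>A. monochromatic f e then 1 else 0 :: int)"
        by (cases "\<forall>e\<in>A. monochromatic f e") (auto simp: prod_zero_iff)
    qed
    finally show ?thesis .
  qed
  have "int (card (proper_colorings V E L))
      = (\<Sum>f\<in>PiE V L. if \<forall>e\<in>E. \<not> monochromatic f e then 1 else 0)"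
    using finP by (simp add: proper_colorings_def proper sum.If_cases Int_def)
  also have "\<dots> = (\<Sum>A\<in>Pow E. \<Sum>f\<in>PiE V L. (- 1) ^ card A * (if \<forall>e\<in>A. monochromatic f e then 1 else 0))"
    by (simp only: ind) (rule sum.swap)
  also have "\<dots> = (\<Sum>A\<in>Pow E. (- 1) ^ card A * int (card {f \<in> PiE V L. \<forall>e\<in>A. monochromatic f e}))"
    using finP by (simp add: sum.If_cases Int_def flip: sum_distrib_left)
  finally show ?thesis .
qed

section \<open>Defects of lists along edges\<close>

text \<open>For a \<open>k\<close>-assignment and an edge this is the number of colors of one end
  missing at the other, the same from both ends; it vanishes exactly if the two lists agree. The
  intersection over the edge avoids ordering its ends.\<close>

definition list_defect :: "nat \<Rightarrow> ('a \<Rightarrow> nat set) \<Rightarrow> 'a set \<Rightarrow> nat" where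
  "list_defect k L e = k - card (\<Inter>x\<in>e. L x)"

text \<open>Along a walk from \<open>u\<close> to \<open>v\<close>, a color of \<open>L u\<close>
  absent from \<open>L v\<close> must be lost on some edge.\<close>

lemma card_list_diff_le:
  assumes G: "simple_graph V E" "connected_graph V E" and L: "k_assignment V k L"
    and uv: "u \<in> V" "v \<in> V"
  shows "card (L u - L v) \<le> 2 * sum (list_defect k L) E"
proof -
  \<comment> \<open>On an edge this is the symmetric difference of the two lists. It is insensitive
    to the direction of traversal and has twice the defect as its size, whence the factor 2.\<close>
  let ?W = "\<lambda>e. (\<Union>x\<in>e. L x) - (\<Inter>x\<in>e. L x)"
  have finE: "finite E"
    using G by (intro finite_subset[of E "Pow V"]) (auto simp: simple_graph_def)
  have W: "finite (?W e) \<and> card (?W e) \<le> 2 * list_defect k L e" if "e \<in> E" for e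
  proof -
    obtain x y where e: "e = {x, y}" "x \<in> V" "y \<in> V"
      using G(1) \<open>e \<in> E\<close> by (auto simp: simple_graph_def card_2_iff)
    have fin: "finite (L x)" "finite (L y)" and c: "card (L x) = k" "card (L y) = k"
      using L e by (auto simp: k_assignment_def)
    have "?W e = (L x - L x \<inter> L y) \<union> (L y - L x \<inter> L y)"
      using e by auto
    moreover have "card (L x - L x \<inter> L y) = k - card (L x \<inter> L y)" "card (L y - L x \<inter> L y) = k - card (L x \<inter> L y)"
      using fin c by (subst card_Diff_subset; simp)+
    moreover have "list_defect k L e = k - card (L x \<inter> L y)"
      using e by (simp add: list_defect_def)
    ultimately show ?thesis
      using fin card_Un_le[of "L x - L x \<inter> L y" "L y - L x \<inter> L y"] by simp
  qed
  have step: "c \<in> (\<Union>e\<in>E. ?W e)"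
    if "(u, v) \<in> {(x, y). {x, y} \<in> E}\<^sup>*" "c \<in> L u" "c \<notin> L v" for c
    using that
  proof (induction rule: rtrancl_induct)
    case (step y z)
    then show ?case
      by (cases "c \<in> L y") (auto intro!: bexI[of _ "{y, z}"])
  qed simp
  have "L u - L v \<subseteq> (\<Union>e\<in>E. ?W e)"
    using step G(2) uv unfolding connected_graph_def by blast
  then have "card (L u - L v) \<le> card (\<Union>e\<in>E. ?W e)"
    using finE W by (intro card_mono) auto
  also have "\<dots> \<le> (\<Sum>e\<in>E. card (?W e))"
    by (rule card_UN_le[OF finE])
  also have "\<dots> \<le> (\<Sum>e\<in>E. 2 * list_defect k L e)"
    using W by (intro sum_mono) auto
  finally show ?thesis
    by (simp add: sum_distrib_left)
qed

text \<open>Merging the ends of the edge leaves \<open>card V - 1\<close> free vertices. The merged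
  vertex has \<open>card (L u \<inter> L v)\<close> colors for \<open>L\<close> but \<open>k\<close>
  colors for the constant list, and the difference is the defect.\<close>

lemma card_monochromatic_edge:
  assumes "finite V" "e \<subseteq> V" "card e = 2"
    and L: "k_assignment V k L" and K: "finite K" "card K = k"
  shows "card {f \<in> PiE V L. monochromatic f e} + list_defect k L e * k ^ (card V - 2)
    \<le> card {f \<in> PiE V (\<lambda>_. K). monochromatic f e}"
proof -
  obtain u v where e: "e = {u, v}" "u \<noteq> v"
    using \<open>card e = 2\<close> by (auto simp: card_2_iff)
  have uv: "u \<in> V" "v \<in> V"
    using e \<open>e \<subseteq> V\<close> by auto
  have finL: "finite (L u)" "card (L u) = k"
    using L uv by (auto simp: k_assignment_def)
  have cV: "card (V - {v}) = card V - 1"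
    using \<open>finite V\<close> uv by simp
  have "card {u, v} \<le> card V"
    using uv \<open>finite V\<close> by (intro card_mono) auto
  \<comment> \<open>The two ends of \<open>e\<close> keep the exponent from being truncated, so a
    factor \<open>k\<close> can be split off.\<close>
  then have V2: "card V - 1 = Suc (card V - 2)"
    using e(2) by simp
  have le: "card (L u \<inter> L v) \<le> k"
    using finL card_mono[of "L u" "L u \<inter> L v"] by auto
  have "card {f \<in> PiE V L. monochromatic f e} \<le> card (L u \<inter> L v) * k ^ (card (V - {v}) - 1)"
  proof (rule card_determined_le)
    show "u \<in> V - {v}" "finite V" "V - {v} \<subseteq> V" "k_assignment V k L" "finite (L u \<inter> L v)"
      using assms uv e finL by auto
    show "{f \<in> PiE V L. monochromatic f e} \<subseteq> PiE V L"
      by auto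
    show "f u \<in> L u \<inter> L v" if "f \<in> {f \<in> PiE V L. monochromatic f e}" for f
    proof -
      have "f \<in> PiE V L" "f u = f v"
        using that unfolding monochromatic_def e(1) by blast+
      then show ?thesis
        using uv PiE_mem by (metis IntI)
    qed
    show "\<forall>x\<in>V. f x = g x" if "f \<in> {f \<in> PiE V L. monochromatic f e}" "g \<in> {f \<in> PiE V L. monochromatic f e}"
      "\<forall>x\<in>V - {v}. f x = g x" for f g
    proof -
      have "f v = f u" "g v = g u"
        using that(1,2) unfolding monochromatic_def e(1) by blast+
      moreover have "f u = g u"
        using that(3) uv e(2) by auto
      ultimately show ?thesis
        using that(3) by auto
    qed
  qed
  also have "card (V - {v}) - 1 = card V - 2"
    using cV by simp
  finally have upper: "card {f \<in> PiE V L. monochromatic f e} \<le> card (L u \<inter> L v) * k ^ (card V - 2)" .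
  have "card (PiE (V - {v}) (\<lambda>_. K)) \<le> card {f \<in> PiE V (\<lambda>_. K). monochromatic f e}"
  proof (rule card_inj_on_le[of "\<lambda>g. g(v := g u)"])
    show "inj_on (\<lambda>g. g(v := g u)) (PiE (V - {v}) (\<lambda>_. K))"
    proof (rule inj_onI)
      fix f g assume fg: "f \<in> PiE (V - {v}) (\<lambda>_. K)" "g \<in> PiE (V - {v}) (\<lambda>_. K)"
        and eq: "f(v := f u) = g(v := g u)"
      have "f x = g x" if "x \<in> V - {v}" for x
        using fun_cong[OF eq, of x] that by simp
      then show "f = g"
        using fg by (meson PiE_ext)
    qed
    show "(\<lambda>g. g(v := g u)) ` PiE (V - {v}) (\<lambda>_. K) \<subseteq> {f \<in> PiE V (\<lambda>_. K). monochromatic f e}"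
      using uv e by (auto simp: monochromatic_def PiE_def Pi_def extensional_def)
    show "finite {f \<in> PiE V (\<lambda>_. K). monochromatic f e}"
      using \<open>finite V\<close> K by (intro finite_subset[OF _ finite_PiE[of V "\<lambda>_. K"]]) auto
  qed
  then have lower: "k * k ^ (card V - 2) \<le> card {f \<in> PiE V (\<lambda>_. K). monochromatic f e}"
    using \<open>finite V\<close> K cV V2 by (simp add: card_PiE)
  have "card (L u \<inter> L v) * k ^ (card V - 2) + list_defect k L e * k ^ (card V - 2) = k * k ^ (card V - 2)"
    using le by (simp add: list_defect_def e(1) flip: add_mult_distrib)
  then show ?thesis
    using upper lower by linarith
qed

section \<open>Gain at the identity and loss at the other automorphisms\<close>

text \<open>The two inclusion-exclusion sums are compared term by term. The empty set contributes
  equally to both. A single edge enters with a minus sign, so having fewer monochromatic colorings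
  is a gain for \<open>L\<close>. For larger sets two of the edges limit the freedom to
  \<open>card V - 2\<close> vertices. The error is granted to all \<open>2 ^ card E\<close> sets
  alike.\<close>

lemma card_proper_colorings_ge:
  assumes G: "simple_graph V E" "connected_graph V E" and L: "k_assignment V k L"
    and "v0 \<in> V" "k \<ge> 1" "card V \<ge> 3"
  defines "D \<equiv> sum (list_defect k L) E"
  shows "card (proper_colorings V E (\<lambda>_. L v0)) + D * k ^ (card V - 2)
    \<le> card (proper_colorings V E L) + 2 ^ card E * (card V * (2 * D * k ^ (card V - 3)))"
proof -
  let ?K = "\<lambda>_::'a. L v0"
  let ?N = "\<lambda>M A. int (card {f \<in> PiE V M. \<forall>e\<in>A. monochromatic f e})"
  define X where "X = card V * (2 * D * k ^ (card V - 3))"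
  have finV: "finite V"
    using G by (simp add: simple_graph_def)
  have finE: "finite E"
    using G by (intro finite_subset[of E "Pow V"]) (auto simp: simple_graph_def)
  have K: "k_assignment V k ?K" "finite (L v0)" "card (L v0) = k"
    using L \<open>v0 \<in> V\<close> by (auto simp: k_assignment_def)
  \<comment> \<open>The inner sum is the gain of \<open>A\<close>: the defect term if
    \<open>A\<close> consists of one edge, and 0 otherwise. This form covers all \<open>A\<close> at
    once and adds up to the total gain.\<close>
  have term_le: "(- 1) ^ card A * ?N ?K A
      + (\<Sum>e\<in>E. if A = {e} then int (list_defect k L e * k ^ (card V - 2)) else 0)
      \<le> (- 1) ^ card A * ?N L A + int X" if A: "A \<in> Pow E" for A
  proof -
    consider "A = {}" | e where "A = {e}" "e \<in> E" | e1 e2 where "e1 \<in> A" "e2 \<in> A" "e1 \<noteq> e2"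
      using A by (metis PowD all_not_in_conv insert_subset singletonI subset_singletonD subsetI singletonD)
    then show ?thesis
    proof cases
      case 1
      have "card (PiE V L) = card (PiE V ?K)"
        using finV L K by (simp add: card_PiE k_assignment_def)
      then show ?thesis
        using 1 by simp
    next
      case 2
      have "(\<Sum>e'\<in>E. if A = {e'} then int (list_defect k L e' * k ^ (card V - 2)) else 0)
          = (\<Sum>e'\<in>E. if e = e' then int (list_defect k L e' * k ^ (card V - 2)) else 0)"
        using 2 by (intro sum.cong) auto
      also have "\<dots> = int (list_defect k L e * k ^ (card V - 2))"
        using 2 finE by simp
      finally have *: "(\<Sum>e'\<in>E. if A = {e'} then int (list_defect k L e' * k ^ (card V - 2)) else 0)
        = int (list_defect k L e * k ^ (card V - 2))" .
      have "card {f \<in> PiE V L. monochromatic f e} + list_defect k L e * k ^ (card V - 2)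
          \<le> card {f \<in> PiE V ?K. monochromatic f e}"
        using card_monochromatic_edge[OF finV _ _ L K(2,3), of e] G(1) 2
        by (auto simp: simple_graph_def)
      then have "?N L A + int (list_defect k L e * k ^ (card V - 2)) \<le> ?N ?K A"
        unfolding 2 by (simp flip: of_nat_add of_nat_mult of_nat_power)
      then show ?thesis
        unfolding * using 2 by simp
    next
      case 3
      have "A \<noteq> {e}" for e
        using 3 by auto
      then have zero: "(\<Sum>e\<in>E. if A = {e} then int (list_defect k L e * k ^ (card V - 2)) else 0) = 0"
        by simp
      have det: "\<exists>T\<subseteq>V. v \<in> T \<and> card T \<le> Suc (card V - 3) \<and>
          (\<forall>f g :: 'a \<Rightarrow> nat. (\<forall>e\<in>A. monochromatic f e) \<longrightarrow> (\<forall>e\<in>A. monochromatic g e) \<longrightarrow>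
            (\<forall>x\<in>T. f x = g x) \<longrightarrow> (\<forall>x\<in>V. f x = g x))" if v: "v \<in> V" for v
      proof -
        obtain T where T: "T \<subseteq> V" "v \<in> T" "card T + 2 \<le> card V"
          "\<And>f g :: 'a \<Rightarrow> nat. monochromatic f e1 \<and> monochromatic f e2 \<Longrightarrow>
            monochromatic g e1 \<and> monochromatic g e2 \<Longrightarrow>
            (\<forall>x\<in>T. f x = g x) \<Longrightarrow> (\<forall>x\<in>V. f x = g x)"
          using two_edges_determine[where ?'b = nat, OF G(1) _ _ 3(3) v] A 3 by blast
        show ?thesis
        proof (intro exI[of _ T] conjI allI impI)
          show "card T \<le> Suc (card V - 3)"
            using T(3) by simp
          fix f g :: "'a \<Rightarrow> nat"
          assume "\<forall>e\<in>A. monochromatic f e" "\<forall>e\<in>A. monochromatic g e" "\<forall>x\<in>T. f x = g x"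
          with 3(1,2) show "\<forall>x\<in>V. f x = g x"
            by (intro T(4)[of f g]) simp_all
        qed (fact T)+
      qed
      \<comment> \<open>The sign of the term depends on the parity of \<open>card A\<close>, so the
        comparison is needed in both directions.\<close>
      have "card {f \<in> PiE V L. \<forall>e\<in>A. monochromatic f e}
          \<le> card {f \<in> PiE V ?K. \<forall>e\<in>A. monochromatic f e} + X"
        unfolding X_def D_def
        using card_list_diff_le[OF G L _ \<open>v0 \<in> V\<close>]
        by (intro card_lists_diff_le[OF finV L K(1) \<open>k \<ge> 1\<close> det])
      moreover have "card {f \<in> PiE V ?K. \<forall>e\<in>A. monochromatic f e}
          \<le> card {f \<in> PiE V L. \<forall>e\<in>A. monochromatic f e} + X"
        unfolding X_def D_def
        using card_list_diff_le[OF G L \<open>v0 \<in> V\<close>]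
        by (intro card_lists_diff_le[OF finV K(1) L \<open>k \<ge> 1\<close> det])
      ultimately show ?thesis
        unfolding zero by (cases "even (card A)") simp_all
    qed
  qed
  have gain: "(\<Sum>A\<in>Pow E. \<Sum>e\<in>E. if A = {e} then int (list_defect k L e * k ^ (card V - 2)) else 0)
      = int (D * k ^ (card V - 2))"
  proof -
    have "(\<Sum>A\<in>Pow E. if A = {e} then c else 0) = c" if "e \<in> E" for e and c :: int
      using finE that by simp
    then show ?thesis
      by (subst sum.swap) (simp add: D_def sum_distrib_right)
  qed
  have "int (card (proper_colorings V E ?K)) + int (D * k ^ (card V - 2))
      = (\<Sum>A\<in>Pow E. (- 1) ^ card A * ?N ?K A
        + (\<Sum>e\<in>E. if A = {e} then int (list_defect k L e * k ^ (card V - 2)) else 0))"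
    unfolding sum.distrib gain using card_proper_colorings_inclusion_exclusion[OF G(1), of ?K] K by simp
  also have "\<dots> \<le> (\<Sum>A\<in>Pow E. (- 1) ^ card A * ?N L A + int X)"
    by (rule sum_mono[OF term_le])
  also have "\<dots> = int (card (proper_colorings V E L)) + 2 ^ card E * int X"
    using card_proper_colorings_inclusion_exclusion[OF G(1), of L] L finE
    by (simp add: sum.distrib card_Pow k_assignment_def)
  finally have "int (card (proper_colorings V E ?K) + D * k ^ (card V - 2))
      \<le> int (card (proper_colorings V E L) + 2 ^ card E * X)"
    by simp
  then show ?thesis
    unfolding X_def by (simp only: of_nat_le_iff)
qed

text \<open>If some cycle of \<open>p\<close> contains two adjacent vertices, no proper coloring is
  fixed by \<open>p\<close> and nothing can be lost. Otherwise a transversal of the cycles has at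
  most \<open>r + 1\<close> vertices, and a loss requires a changed color at one vertex.\<close>

lemma card_fixed_colorings_ge:
  assumes G: "simple_graph V E" "connected_graph V E" and L: "k_assignment V k L"
    and "v0 \<in> V" "k \<ge> 1" and p: "p permutes V"
    and cycles: "\<forall>C \<in> cycles_of_perm V p. pairwise_nonadjacent E C \<Longrightarrow>
      card (cycles_of_perm V p) \<le> Suc r"
  defines "D \<equiv> sum (list_defect k L) E"
  shows "card (fixed_colorings V E (\<lambda>_. L v0) p)
    \<le> card (fixed_colorings V E L p) + card V * (2 * D * k ^ r)"
proof (cases "\<forall>C \<in> cycles_of_perm V p. pairwise_nonadjacent E C")
  case True
  have finV: "finite V"
    using G by (simp add: simple_graph_def)
  have K: "k_assignment V k (\<lambda>_. L v0)"
    using L \<open>v0 \<in> V\<close> by (auto simp: k_assignment_def)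
  \<comment> \<open>Properness and invariance together form a condition independent of the lists, as
    \<open>card_lists_diff_le\<close> expects.\<close>
  let ?Q = "\<lambda>f :: 'a \<Rightarrow> nat. (\<forall>u v. {u, v} \<in> E \<longrightarrow> f u \<noteq> f v) \<and> f \<circ> p = f"
  have "fixed_colorings V E M p = {f \<in> PiE V M. ?Q f}" for M
    by (auto simp: fixed_colorings_def proper_colorings_def)
  moreover have "card {f \<in> PiE V (\<lambda>_. L v0). ?Q f} \<le> card {f \<in> PiE V L. ?Q f} + card V * (2 * D * k ^ r)"
    unfolding D_def
  proof (rule card_lists_diff_le[OF finV K L \<open>k \<ge> 1\<close>])
    show "\<exists>T\<subseteq>V. v \<in> T \<and> card T \<le> Suc r \<and>
      (\<forall>f g. ?Q f \<longrightarrow> ?Q g \<longrightarrow> (\<forall>x\<in>T. f x = g x) \<longrightarrow> (\<forall>x\<in>V. f x = g x))" if v: "v \<in> V" for v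
    proof -
      obtain T where T: "T \<subseteq> V" "v \<in> T" "card T \<le> card (cycles_of_perm V p)"
        and det: "\<And>f g :: 'a \<Rightarrow> nat. f \<circ> p = f \<Longrightarrow> g \<circ> p = g \<Longrightarrow>
          (\<forall>x\<in>T. f x = g x) \<Longrightarrow> (\<forall>x\<in>V. f x = g x)"
        using cycles_determine[where ?'b = nat, OF finV p v] by blast
      show ?thesis
      proof (intro exI[of _ T] conjI allI impI)
        show "card T \<le> Suc r"
          using T(3) cycles[OF True] by simp
        fix f g :: "'a \<Rightarrow> nat"
        assume "?Q f" "?Q g" "\<forall>x\<in>T. f x = g x"
        then show "\<forall>x\<in>V. f x = g x"
          by (intro det[of f g]) simp_all
      qed (fact T)+
    qed
  qed (rule card_list_diff_le[OF G L \<open>v0 \<in> V\<close>])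
  ultimately show ?thesis
    by simp
next
  case False
  then obtain x u v where x: "u \<in> orbit p x" "v \<in> orbit p x" "{u, v} \<in> E"
    by (auto simp: cycles_of_perm_def pairwise_nonadjacent_def)
  have const: "f y = f x" if "f \<circ> p = f" "y \<in> orbit p x" for f :: "'a \<Rightarrow> nat" and y
    using that(2) that(1) by induct (auto simp: fun_eq_iff)
  have "f \<notin> fixed_colorings V E (\<lambda>_. L v0) p" for f
  proof
    assume f: "f \<in> fixed_colorings V E (\<lambda>_. L v0) p"
    then have "f \<circ> p = f"
      by (simp add: fixed_colorings_def)
    then have "f u = f v"
      using const x(1,2) by metis
    then show False
      using f x(3) unfolding fixed_colorings_def proper_colorings_def by blast
  qed
  then have "fixed_colorings V E (\<lambda>_. L v0) p = {}"
    by blast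
  then show ?thesis
    by simp
qed

section \<open>The comparison for large \<open>k\<close>\<close>

text \<open>Burnside's count is exact for the constant assignment and a lower bound for
  \<open>L\<close>, so comparing the sums of fixed colorings suffices. The threshold depends on the
  graph alone; its summand 1 provides \<open>k \<ge> 1\<close>.\<close>

lemma u_list_const_le:
  assumes G: "simple_graph V E" "connected_graph V E" and L: "k_assignment V k L"
    and n: "card V \<ge> 3" and k: "k \<ge> 1 + 2 * card V * (2 ^ card E + card (Aut V E))"
    and cycles: "\<And>p. p \<in> Aut V E \<Longrightarrow> p \<noteq> id \<Longrightarrow>
      \<forall>C \<in> cycles_of_perm V p. pairwise_nonadjacent E C \<Longrightarrow>
      card (cycles_of_perm V p) \<le> card V - 2"
  shows "u_list V E (\<lambda>_. {1..k}) \<le> u_list V E L"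
proof -
  let ?A = "Aut V E"
  define D where "D = sum (list_defect k L) E"
  define X where "X = card V * (2 * D * k ^ (card V - 3))"
  obtain v0 where v0: "v0 \<in> V"
    using G(2) by (auto simp: connected_graph_def)
  let ?K = "\<lambda>_::'a. L v0"
  have finV: "finite V"
    using G by (simp add: simple_graph_def)
  have K: "finite (L v0)" "card (L v0) = k"
    using L v0 by (auto simp: k_assignment_def)
  have finA: "finite ?A"
    by (rule finite_Aut[OF finV])
  have r: "Suc (card V - 3) = card V - 2"
    using n by simp
  have fix_id: "fixed_colorings V E M id = proper_colorings V E M" for M
    by (auto simp: fixed_colorings_def)
  \<comment> \<open>The total error carries only the power \<open>card V - 3\<close>, so the
    additional factor \<open>k\<close> in the gain absorbs its constant.\<close>
  have "(2 ^ card E + card ?A) * X = 2 * card V * (2 ^ card E + card ?A) * (D * k ^ (card V - 3))"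
    by (simp add: X_def algebra_simps)
  also have "\<dots> \<le> k * (D * k ^ (card V - 3))"
    using k by (intro mult_right_mono) auto
  also have "\<dots> = D * k ^ (card V - 2)"
    by (simp flip: r)
  finally have X: "2 ^ card E * X + card ?A * X \<le> D * k ^ (card V - 2)"
    by (simp add: algebra_simps)
  have id: "card (fixed_colorings V E ?K id) + D * k ^ (card V - 2)
      \<le> card (fixed_colorings V E L id) + 2 ^ card E * X"
    unfolding fix_id X_def D_def using card_proper_colorings_ge[OF G L v0 _ n] k by simp
  have non_id: "card (fixed_colorings V E ?K p) \<le> card (fixed_colorings V E L p) + X"
    if "p \<in> ?A - {id}" for p
    unfolding X_def D_def
    using that k cycles[of p] r by (intro card_fixed_colorings_ge[OF G L v0]) (auto simp: Aut_def)
  have "(\<Sum>p\<in>?A - {id}. card (fixed_colorings V E ?K p))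
      \<le> (\<Sum>p\<in>?A - {id}. card (fixed_colorings V E L p) + X)"
    by (rule sum_mono[OF non_id])
  also have "\<dots> \<le> (\<Sum>p\<in>?A - {id}. card (fixed_colorings V E L p)) + card ?A * X"
    using finA by (simp add: sum.distrib)
  finally have "(\<Sum>p\<in>?A. card (fixed_colorings V E ?K p)) \<le> (\<Sum>p\<in>?A. card (fixed_colorings V E L p))"
    using id X finA by (simp add: sum.remove[of ?A id])
  \<comment> \<open>The estimates so far refer to the list of \<open>v0\<close>; since it has
    \<open>k\<close> colors, they carry over to \<open>{1..k}\<close>.\<close>
  moreover have "(\<Sum>p\<in>?A. card (fixed_colorings V E (\<lambda>_. {1..k}) p)) \<le> (\<Sum>p\<in>?A. card (fixed_colorings V E ?K p))"
    using K by (intro sum_mono card_fixed_colorings_const_le finV G) (auto simp: Aut_def)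
  moreover have "(\<Sum>p\<in>?A. card (fixed_colorings V E L p)) \<le> u_list V E L * card ?A"
    using L by (intro sum_card_fixed_colorings_le finV) (auto simp: k_assignment_def)
  ultimately have "u_list V E (\<lambda>_. {1..k}) * card ?A \<le> u_list V E L * card ?A"
    using sum_card_fixed_colorings_const[OF finV finite_atLeastAtMost, of E 1 k] by linarith
  moreover have "card ?A > 0"
    using finA Aut_id by (metis card_gt_0_iff empty_iff)
  ultimately show ?thesis
    by simp
qed

theorem theorem1p8:
  fixes V :: "'a set" and E :: "'a set set" and n m :: nat
  assumes "simple_graph V E" and "card V = n"
    and "connected_graph V E"
    and "card E = m" and "m \<ge> 4"
    and "\<And>p. p \<in> Aut V E \<Longrightarrow> p \<noteq> id \<Longrightarrow>
           (\<forall>C \<in> cycles_of_perm V p. pairwise_nonadjacent E C) \<Longrightarrow>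
           int (card (cycles_of_perm V p)) \<le> int n - 2"
  shows "\<exists>N::nat. \<forall>k\<ge>N.
           unlabeled_list_color_function V (unlabeled_graph V E) k =
           unlabeled_chromatic_polynomial V (unlabeled_graph V E) k"
proof -
  have finV: "finite V"
    using assms(1) by (simp add: simple_graph_def)
  have "\<not> card E \<le> 1"
    using assms by simp
  then obtain e1 e2 where e: "e1 \<in> E" "e2 \<in> E" "e1 \<noteq> e2"
    using card_le_Suc0_iff_eq[of E] assms(4,5) by (metis One_nat_def card.infinite zero_le_one)
  obtain v where v: "v \<in> V"
    using assms(3) by (auto simp: connected_graph_def)
  \<comment> \<open>Only the size of \<open>T\<close> matters here: it contains \<open>v\<close> and
    leaves out two vertices, so there are at least three vertices and \<open>card V - 3\<close> is
    not truncated.\<close>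
  obtain T where T: "T \<subseteq> V" "v \<in> T" "card T + 2 \<le> card V"
    using two_edges_determine[where ?'b = nat, OF assms(1) e v] by (elim exE conjE)
  have "card T > 0"
    using T finV finite_subset by (metis card_gt_0_iff empty_iff)
  then have n: "card V \<ge> 3"
    using T(3) by simp
  have cycles: "card (cycles_of_perm V p) \<le> card V - 2"
    if "p \<in> Aut V E" "p \<noteq> id" "\<forall>C \<in> cycles_of_perm V p. pairwise_nonadjacent E C" for p
    using assms(6)[OF that] assms(2) by linarith
  show ?thesis
  proof (intro exI allI impI)
    \<comment> \<open>This bound instantiates \<open>N\<close>.\<close>
    fix k assume k: "k \<ge> 1 + 2 * card V * (2 ^ card E + card (Aut V E))"
    let ?u = "u_list V E (\<lambda>_. {1..k})"
    let ?S = "{u_list V E L | L. k_assignment V k L}"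
    have "?u \<in> ?S"
      by (auto simp: k_assignment_def intro!: exI[of _ "\<lambda>_. {1..k}"])
    moreover have "?u \<le> u" if "u \<in> ?S" for u
      using that u_list_const_le[OF assms(1,3) _ n k cycles] by blast
    ultimately have "Inf ?S = ?u"
      by (rule cInf_eq_minimum)
    then show "unlabeled_list_color_function V (unlabeled_graph V E) k =
        unlabeled_chromatic_polynomial V (unlabeled_graph V E) k"
      by (simp add: unlabeled_list_color_function_eq[OF assms(1)]
          unlabeled_chromatic_polynomial_eq[OF assms(1)])
  qed
qed

end
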